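(* Let $m\geqslant 3$, $n\geqslant 3$ be odd integers and let $M\geqslant m$, $N\geqslant n$ be odd integers. Then the labelings $\mathrm{HALL}_{M,N}(m,n)$ and $\mathrm{VALL}_{M,N}(m,n)$ are partial bicentrally balanced $C_4$-face-magic labelings on the $m\times n$ subgrid of $\mathcal{P}_{M,N}$.
   Context: Write $m=2m_0+1$, $n=2n_0+1$, $m_0^{+}=m_0+1$, $n_0^{+}=n_0+1$. $\mathrm{Grid}(m,n)=\{(i,j):1\leqslant i\leqslant m,1\leqslant j\leqslant n\}$, and $P_m\times P_n$ is the planar $m\times n$ grid graph on it (edges $(i,j)$–$(i+1,j)$ and $(i,j)$–$(i,j+1)$), whose 4-cycle faces are $\{(i,j),(i+1,j),(i,j+1),(i+1,j+1)\}$, $1\leqslant i\leqslant m-1$, $1\leqslant j\leqslant n-1$. A labeling $X=\{x_{i,j}:(i,j)\in\mathrm{Grid}(m,n)\}$ is a partial bicentrally balanced $C_4$-face-magic labeling on the $m\times n$ subgrid of $\mathcal{P}_{M,N}$ if: (1) every 4-cycle face of $P_m\times P_n$ has label sum $2MN+3$; (2) $\{x_{i,j}: i+j \text{ even}\}=\{1,2,\ldots,\tfrac12 mn+\tfrac12\}$; (3) $\{x_{i,j}: i+j\text{ odd}\}=\{MN-\tfrac12 mn+\tfrac32, MN-\tfrac12 mn+\tfrac52,\ldots,MN\}$; (4) $x_{i,j}+x_{m+1-i,n+1-j}=\tfrac12 mn+\tfrac32$ if $i+j$ is even; (5) $x_{i,j}+x_{m+1-i,n+1-j}=2MN-\tfrac12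 mn+\tfrac32$ if $i+j$ is odd; (6) $x_{i,n_0^{+}}<x_{i+2,n_0^{+}}$ for $1\leqslant i\leqslant m-2$ with $i+n_0^{+}$ even, $x_{i,n_0^{+}}>x_{i+2,n_0^{+}}$ for $1\leqslant i\leqslant m-2$ with $i+n_0^{+}$ odd, $x_{m_0^{+},j}<x_{m_0^{+},j+2}$ for $1\leqslant j\leqslant n-2$ with $m_0^{+}+j$ even, and $x_{m_0^{+},j}>x_{m_0^{+},j+2}$ for $1\leqslant j\leqslant n-2$ with $m_0^{+}+j$ odd. $\mathrm{HALL}_{M,N}(m,n)=\{x_{i,j}\}$ is given by: $x_{2i-1,2j-1}=m(j-1)+i$ ($1\leqslant i\leqslant m_0^{+}$, $1\leqslant j\leqslant n_0^{+}$); $x_{2i,2j}=m(j-1)+m_0^{+}+i$ ($1\leqslant i\leqslant m_0$, $1\leqslant j\leqslant n_0$); $x_{2i,2j-1}=MN+m(1-j)+1-i$ ($1\leqslant i\leqslant m_0$, $1\leqslant j\leqslant n_0^{+}$); $x_{2i-1,2j}=MN-mj+m_0^{+}+1-i$ ($1\leqslant i\leqslant m_0^{+}$, $1\leqslant j\leqslant n_0$). $\mathrm{VALL}_{M,N}(m,n)=\{y_{i,j}\}$ is given by: $y_{2i-1,2j-1}=n(i-1)+j$ ($1\leqslant i\leqslant m_0^{+}$, $1\leqslant j\leqslant n_0^{+}$); $y_{2i,2j}=n(i-1)+n_0^{+}+j$ ($1\leqslant i\leqslant m_0$, $1\leqslant j\leqslant n_0$); $y_{2i,2j-1}=MN-ni+n_0^{+}+1-j$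 ($1\leqslant i\leqslant m_0$, $1\leqslant j\leqslant n_0^{+}$); $y_{2i-1,2j}=MN+n(1-i)+1-j$ ($1\leqslant i\leqslant m_0^{+}$, $1\leqslant j\leqslant n_0$). *)

theory Defs
  imports Main
begin

definition Grid :: "int \<Rightarrow> int \<Rightarrow> (int \<times> int) set" where
  "Grid m n = {(i, j). 1 \<le> i \<and> i \<le> m \<and> 1 \<le> j \<and> j \<le> n}"

definition C4_faces :: "int \<Rightarrow> int \<Rightarrow> (int \<times> int) set set" where
  "C4_faces m n = {{(i, j), (i + 1, j), (i, j + 1), (i + 1, j + 1)} | i j.
     1 \<le> i \<and> i \<le> m - 1 \<and> 1 \<le> j \<and> j \<le> n - 1}"

definition half_floor :: "int \<Rightarrow> int" where
  "half_floor m = (m - 1) div 2"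

definition half_ceil :: "int \<Rightarrow> int" where
  "half_ceil m = half_floor m + 1"

text \<open>
  For \<open>m = 2 m\<^sub>0 + 1\<close> these are \<open>m\<^sub>0\<close> and \<open>m\<^sub>0 + 1\<close>. A labeling is a function
  \<open>x\<close> on pairs of indices, of which only the values on the grid matter. The predicate below is meant
  for odd \<open>m\<close>, \<open>n\<close>: then \<open>m * n\<close> is odd and every division by 2 in it is exact.
\<close>

definition partial_bicentrally_balanced ::
  "int \<Rightarrow> int \<Rightarrow> int \<Rightarrow> int \<Rightarrow> (int \<Rightarrow> int \<Rightarrow> int) \<Rightarrow> bool" where
  "partial_bicentrally_balanced M N m n x \<longleftrightarrow>
     (\<forall>F \<in> C4_faces m n. (\<Sum>(i, j) \<in> F. x i j) = 2 * M * N + 3) \<and>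
     {x i j | i j. (i, j) \<in> Grid m n \<and> even (i + j)} = {1 .. (m * n + 1) div 2} \<and>
     {x i j | i j. (i, j) \<in> Grid m n \<and> odd (i + j)} = {M * N - (m * n - 3) div 2 .. M * N} \<and>
     (\<forall>(i, j) \<in> Grid m n. even (i + j) \<longrightarrow>
        x i j + x (m + 1 - i) (n + 1 - j) = (m * n + 3) div 2) \<and>
     (\<forall>(i, j) \<in> Grid m n. odd (i + j) \<longrightarrow>
        x i j + x (m + 1 - i) (n + 1 - j) = 2 * M * N - (m * n - 3) div 2) \<and>
     (\<forall>i. 1 \<le> i \<and> i \<le> m - 2 \<and> even (i + half_ceil n) \<longrightarrow>
        x i (half_ceil n) < x (i + 2) (half_ceil n)) \<and>
     (\<forall>i. 1 \<le> i \<and> i \<le> m - 2 \<and> odd (i + half_ceil n) \<longrightarrow>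
        x i (half_ceil n) > x (i + 2) (half_ceil n)) \<and>
     (\<forall>j. 1 \<le> j \<and> j \<le> n - 2 \<and> even (half_ceil m + j) \<longrightarrow>
        x (half_ceil m) j < x (half_ceil m) (j + 2)) \<and>
     (\<forall>j. 1 \<le> j \<and> j \<le> n - 2 \<and> odd (half_ceil m + j) \<longrightarrow>
        x (half_ceil m) j > x (half_ceil m) (j + 2))"

text \<open>
  The labelings are specified by four families of equations, according to the parities of the two
  indices. Both \<open>2 a - 1\<close> and \<open>2 a\<close> determine \<open>a\<close> as \<open>(i + 1) div 2\<close>. The
  original parametrized equations are recovered in \<open>HALL_eqs\<close> and \<open>VALL_eqs\<close>.
\<close>

definition HALL :: "int \<Rightarrow> int \<Rightarrow> int \<Rightarrow> int \<Rightarrow> int \<Rightarrow> int \<Rightarrow> int" where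
  "HALL M N m n i j =
    (let a = (i + 1) div 2; b = (j + 1) div 2 in
     if odd i \<and> odd j then m * (b - 1) + a
     else if even i \<and> even j then m * (b - 1) + half_ceil m + a
     else if even i \<and> odd j then M * N + m * (1 - b) + 1 - a
     else M * N - m * b + half_ceil m + 1 - a)"

definition VALL :: "int \<Rightarrow> int \<Rightarrow> int \<Rightarrow> int \<Rightarrow> int \<Rightarrow> int \<Rightarrow> int" where
  "VALL M N m n i j =
    (let a = (i + 1) div 2; b = (j + 1) div 2 in
     if odd i \<and> odd j then n * (a - 1) + b
     else if even i \<and> even j then n * (a - 1) + half_ceil n + b
     else if even i \<and> odd j then M * N - n * a + half_ceil n + 1 - b
     else M * N + n * (1 - a) + 1 - b)"

lemma HALL_eqs:
  "HALL M N m n (2 * i - 1) (2 * j - 1) = m * (j - 1) + i"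
  "HALL M N m n (2 * i) (2 * j) = m * (j - 1) + half_ceil m + i"
  "HALL M N m n (2 * i) (2 * j - 1) = M * N + m * (1 - j) + 1 - i"
  "HALL M N m n (2 * i - 1) (2 * j) = M * N - m * j + half_ceil m + 1 - i"
  by (simp_all add: HALL_def)

lemma VALL_eqs:
  "VALL M N m n (2 * i - 1) (2 * j - 1) = n * (i - 1) + j"
  "VALL M N m n (2 * i) (2 * j) = n * (i - 1) + half_ceil n + j"
  "VALL M N m n (2 * i) (2 * j - 1) = M * N - n * i + half_ceil n + 1 - j"
  "VALL M N m n (2 * i - 1) (2 * j) = M * N + n * (1 - i) + 1 - j"
  by (simp_all add: VALL_def)

end

theory Submission
  imports Defs
begin

text \<open>
  Write \<open>m = 2 p + 1\<close>. In \<open>HALL\<close>, the even-parity labels of columns \<open>2 b - 1\<close> and \<open>2 b\<close> run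
  consecutively through the block \<open>m (b - 1) + 1, \<dots>, m b\<close> (the last, odd column contributing only the
  first \<open>p + 1\<close> labels of its block), and the odd-parity labels run downwards from \<open>M N\<close> in the same
  way with blocks of \<open>p\<close> and \<open>p + 1\<close> labels; hence Euclidean division by \<open>m\<close> locates every label.
  \<open>VALL\<close> is the transpose of \<open>HALL\<close> with the roles of the two dimensions exchanged, and being
  bicentrally balanced is invariant under transposition.
\<close>

lemma sum_C4_face:
  fixes f :: "int \<Rightarrow> int \<Rightarrow> int"
  shows "(\<Sum>(k, l) \<in> {(i, j), (i + 1, j), (i, j + 1), (i + 1, j + 1)}. f k l) =
    f i j + f (i + 1) j + f i (j + 1) + f (i + 1) (j + 1)"
  by simp

text \<open>The four corners of a face are distinct, so the sum over the set is a plain four-term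
  sum; this form admits direct algebra.\<close>

lemma C4_faces_magic_iff:
  fixes f :: "int \<Rightarrow> int \<Rightarrow> int"
  shows "(\<forall>F \<in> C4_faces m n. (\<Sum>(i, j) \<in> F. f i j) = s) \<longleftrightarrow>
    (\<forall>i j. 1 \<le> i \<and> i \<le> m - 1 \<and> 1 \<le> j \<and> j \<le> n - 1 \<longrightarrow>
      f i j + f (i + 1) j + f i (j + 1) + f (i + 1) (j + 1) = s)"
  unfolding C4_faces_def sum_C4_face[symmetric] by blast

text \<open>Swapping coordinates preserves faces, the parity of \<open>i + j\<close> and the central
  reflection, and it exchanges the two monotonicity conditions.\<close>

lemma partial_bicentrally_balanced_transpose:
  assumes "partial_bicentrally_balanced M N m n x"
  shows "partial_bicentrally_balanced N M n m (\<lambda>i j. x j i)"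
proof -
  have labels: "{x j i | i j. (i, j) \<in> Grid n m \<and> P (i + j)} =
      {x i j | i j. (i, j) \<in> Grid m n \<and> P (i + j)}" for P
    unfolding Grid_def by (auto simp: add.commute; metis add.commute)
  have faces: "(\<forall>F \<in> C4_faces n m. (\<Sum>(i, j) \<in> F. x j i) = s) \<longleftrightarrow>
      (\<forall>F \<in> C4_faces m n. (\<Sum>(i, j) \<in> F. x i j) = s)" for s
    unfolding C4_faces_magic_iff by (auto simp: algebra_simps)
  have central: "(\<forall>(i, j) \<in> Grid n m. P (i + j) \<longrightarrow> x j i + x (m + 1 - j) (n + 1 - i) = s) \<longleftrightarrow>
      (\<forall>(i, j) \<in> Grid m n. P (i + j) \<longrightarrow> x i j + x (m + 1 - i) (n + 1 - j) = s)" for P s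
    unfolding Grid_def by (auto simp: add.commute)
  have comm: "2 * N * M = 2 * M * N" "N * M = M * N" "n * m = m * n"
    "half_ceil n + k = k + half_ceil n" "k + half_ceil m = half_ceil m + k" for k
    by simp_all
  show ?thesis
    using assms unfolding partial_bicentrally_balanced_def faces comm
      labels[of even] labels[of "\<lambda>k. odd k"] central[of even] central[of "\<lambda>k. odd k"]
    by blast
qed

lemma VALL_eq_HALL_transpose: "VALL M N m n = (\<lambda>i j. HALL N M n m j i)"
  by (intro ext) (auto simp: VALL_def HALL_def Let_def)

text \<open>Odd numbers take the form \<open>2 * a - 1\<close> to match the left-hand sides of
  \<open>HALL_eqs\<close>.\<close>

lemma parity_cases:
  fixes i :: int
  obtains a where "i = 2 * a" | a where "i = 2 * a - 1"
proof (cases "even i")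
  case False
  then obtain a where "i = 2 * a + 1" by (rule oddE)
  then have "i = 2 * (a + 1) - 1" by simp
  then show ?thesis by (rule that(2))
qed (auto elim: evenE that(1))

lemma half_ceil_odd: "half_ceil (2 * p + 1) = p + 1"
  by (simp add: half_ceil_def half_floor_def)

text \<open>A face meets each of the four parity classes once. The index terms cancel, leaving
  \<open>2 * M * N + 2\<close> plus \<open>2 * half_ceil m - m = 1\<close>.\<close>

lemma HALL_face_sum:
  assumes "odd m"
  shows "HALL M N m n i j + HALL M N m n (i + 1) j + HALL M N m n i (j + 1)
    + HALL M N m n (i + 1) (j + 1) = 2 * M * N + 3"
proof -
  obtain p where m: "m = 2 * p + 1" using assms by (rule oddE)
  show ?thesis
    unfolding m HALL_def Let_def half_ceil_odd
    by (cases "even i"; cases "even j"; elim evenE oddE) (simp_all add: algebra_simps)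
qed

lemma HALL_even_labels:
  assumes "odd m" "m \<ge> 1" "odd n" "n \<ge> 1"
  shows "{HALL M N m n i j | i j. (i, j) \<in> Grid m n \<and> even (i + j)} = {1 .. (m * n + 1) div 2}"
    (is "?L = ?R")
proof -
  obtain p where m: "m = 2 * p + 1" using assms(1) by (rule oddE)
  have half_ceil: "half_ceil m = p + 1" unfolding m by (rule half_ceil_odd)
  obtain q where n: "n = 2 * q + 1" using assms(3) by (rule oddE)
  have p: "p \<ge> 0" using assms m by auto
  have R: "?R = {1 .. m * q + p + 1}" by (simp add: m n algebra_simps)
  have "?L \<subseteq> ?R"
  proof
    fix v assume "v \<in> ?L"
    then obtain i j where v: "v = HALL M N m n i j" and ij: "1 \<le> i" "i \<le> m" "1 \<le> j" "j \<le> n"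
      and par: "even (i + j)" by (auto simp: Grid_def)
    show "v \<in> ?R"
    proof (cases i rule: parity_cases)
      case (1 a)
      with par obtain b where ab: "i = 2 * a" "j = 2 * b"
        by (cases j rule: parity_cases) auto
      have "m * 0 \<le> m * (b - 1)" "m * (b - 1) \<le> m * (q - 1)"
        using ij ab n assms by (intro mult_left_mono; simp)+
      moreover have "m * (q - 1) = m * q - m" by (simp add: right_diff_distrib)
      moreover have "v = m * (b - 1) + p + 1 + a"
        unfolding v ab HALL_eqs half_ceil by simp
      ultimately show ?thesis unfolding R atLeastAtMost_iff using ij ab m p by linarith
    next
      case (2 a)
      with par obtain b where ab: "i = 2 * a - 1" "j = 2 * b - 1"
        by (cases j rule: parity_cases) auto
      have "m * 0 \<le> m * (b - 1)" "m * (b - 1) \<le> m * q"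
        using ij ab n assms by (intro mult_left_mono; simp)+
      moreover have "v = m * (b - 1) + a" unfolding v ab HALL_eqs ..
      ultimately show ?thesis unfolding R atLeastAtMost_iff using ij ab m by linarith
    qed
  qed
  moreover have "?R \<subseteq> ?L"
  proof
    fix v assume "v \<in> ?R"
    then have v: "1 \<le> v" "v - 1 \<le> m * q + p" unfolding R by auto
    \<comment> \<open>Shifting by 1 makes blocks and offsets start at 0: offsets
      \<open>r \<le> p\<close> lie in column \<open>2 * b + 1\<close>, the others in column
      \<open>2 * b + 2\<close>.\<close>
    define b r where "b = (v - 1) div m" and "r = (v - 1) mod m"
    have vbr: "v = m * b + r + 1" by (simp add: b_def r_def)
    have r: "0 \<le> r" "r < m" using assms by (simp_all add: r_def)
    have b: "0 \<le> b" using v assms by (simp add: b_def pos_imp_zdiv_nonneg_iff)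
    have "m * b < m * (q + 1)" using v vbr r p m by (simp add: algebra_simps)
    then have bq: "b \<le> q" using assms by (simp add: mult_less_cancel_left)
    show "v \<in> ?L"
    proof (cases "r \<le> p")
      case True
      have "v = HALL M N m n (2 * (r + 1) - 1) (2 * (b + 1) - 1)"
        unfolding HALL_eqs vbr by simp
      moreover have "(2 * (r + 1) - 1, 2 * (b + 1) - 1) \<in> Grid m n"
        using r b bq True by (simp add: Grid_def m n)
      moreover have "even (2 * (r + 1) - 1 + (2 * (b + 1) - 1))" by simp
      ultimately show ?thesis by blast
    next
      case False
      have "b \<noteq> q" using False v vbr by auto
      then have "(2 * (r - p), 2 * (b + 1)) \<in> Grid m n"
        using r b bq False by (simp add: Grid_def m n)
      moreover have "v = HALL M N m n (2 * (r - p)) (2 * (b + 1))"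
        unfolding HALL_eqs vbr half_ceil by simp
      moreover have "even (2 * (r - p) + 2 * (b + 1))" by simp
      ultimately show ?thesis by blast
    qed
  qed
  ultimately show ?thesis by blast
qed

text \<open>The distance \<open>M * N - v\<close> from the top plays the role that
  \<open>v - 1\<close> has for the even labels. Odd columns now come with even rows, hence hold
  \<open>p\<close> labels, and even columns hold \<open>p + 1\<close>.\<close>

lemma HALL_odd_labels:
  assumes "odd m" "m \<ge> 1" "odd n" "n \<ge> 1"
  shows "{HALL M N m n i j | i j. (i, j) \<in> Grid m n \<and> odd (i + j)} =
    {M * N - (m * n - 3) div 2 .. M * N}" (is "?L = ?R")
proof -
  obtain p where m: "m = 2 * p + 1" using assms(1) by (rule oddE)
  have half_ceil: "half_ceil m = p + 1" unfolding m by (rule half_ceil_odd)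
  obtain q where n: "n = 2 * q + 1" using assms(3) by (rule oddE)
  have p: "p \<ge> 0" using assms m by auto
  have "m * n - 3 = 2 * (m * q + p - 1)" by (simp add: m n algebra_simps)
  then have R: "?R = {M * N - (m * q + p - 1) .. M * N}" by simp
  have "?L \<subseteq> ?R"
  proof
    fix v assume "v \<in> ?L"
    then obtain i j where v: "v = HALL M N m n i j" and ij: "1 \<le> i" "i \<le> m" "1 \<le> j" "j \<le> n"
      and par: "odd (i + j)" by (auto simp: Grid_def)
    show "v \<in> ?R"
    proof (cases i rule: parity_cases)
      case (1 a)
      with par obtain b where ab: "i = 2 * a" "j = 2 * b - 1"
        by (cases j rule: parity_cases) auto
      have "m * 0 \<le> m * (b - 1)" "m * (b - 1) \<le> m * q"
        using ij ab n assms by (intro mult_left_mono; simp)+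
      moreover have "v = M * N - m * (b - 1) + 1 - a"
        unfolding v ab HALL_eqs by (simp add: algebra_simps)
      ultimately show ?thesis unfolding R atLeastAtMost_iff using ij ab m by linarith
    next
      case (2 a)
      with par obtain b where ab: "i = 2 * a - 1" "j = 2 * b"
        by (cases j rule: parity_cases) auto
      have "m * 1 \<le> m * b" "m * b \<le> m * q"
        using ij ab n assms by (intro mult_left_mono; simp)+
      moreover have "v = M * N - m * b + p + 2 - a"
        unfolding v ab HALL_eqs half_ceil by simp
      ultimately show ?thesis unfolding R atLeastAtMost_iff using ij ab m by linarith
    qed
  qed
  moreover have "?R \<subseteq> ?L"
  proof
    fix v assume "v \<in> ?R"
    then have v: "0 \<le> M * N - v" "M * N - v \<le> m * q + p - 1" unfolding R by auto
    define b r where "b = (M * N - v) div m" and "r = (M * N - v) mod m"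
    have "M * N - v = m * b + r" by (simp add: b_def r_def)
    then have vbr: "v = M * N - m * b - r" by simp
    have r: "0 \<le> r" "r < m" using assms by (simp_all add: r_def)
    have b: "0 \<le> b" using v assms by (simp add: b_def pos_imp_zdiv_nonneg_iff)
    have "m * b < m * (q + 1)" using v vbr r p m by (simp add: algebra_simps)
    then have bq: "b \<le> q" using assms by (simp add: mult_less_cancel_left)
    show "v \<in> ?L"
    proof (cases "r < p")
      case True
      have "v = HALL M N m n (2 * (r + 1)) (2 * (b + 1) - 1)"
        unfolding HALL_eqs vbr by (simp add: algebra_simps)
      moreover have "(2 * (r + 1), 2 * (b + 1) - 1) \<in> Grid m n"
        using r b bq True by (simp add: Grid_def m n)
      moreover have "odd (2 * (r + 1) + (2 * (b + 1) - 1))" by simp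
      ultimately show ?thesis by blast
    next
      case False
      \<comment> \<open>Here the last block has only the offsets below \<open>p\<close>.\<close>
      have "b \<noteq> q" using False v vbr by auto
      then have "(2 * (r - p + 1) - 1, 2 * (b + 1)) \<in> Grid m n"
        using r b bq False by (simp add: Grid_def m n)
      moreover have "v = HALL M N m n (2 * (r - p + 1) - 1) (2 * (b + 1))"
        unfolding HALL_eqs vbr half_ceil by (simp add: m algebra_simps)
      moreover have "odd (2 * (r - p + 1) - 1 + 2 * (b + 1))" by simp
      ultimately show ?thesis by blast
    qed
  qed
  ultimately show ?thesis by blast
qed

text \<open>As \<open>m + 1\<close> and \<open>n + 1\<close> are even, the reflection preserves the
  parity of each index, so both labels come from the same formula and the index terms
  cancel.\<close>

lemma HALL_central_sum:
  assumes "odd m" "odd n"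
  shows "HALL M N m n i j + HALL M N m n (m + 1 - i) (n + 1 - j) =
    (if even (i + j) then (m * n + 3) div 2 else 2 * M * N - (m * n - 3) div 2)"
proof -
  obtain p where m: "m = 2 * p + 1" using assms(1) by (rule oddE)
  have half_ceil: "half_ceil m = p + 1" unfolding m by (rule half_ceil_odd)
  obtain q where n: "n = 2 * q + 1" using assms(2) by (rule oddE)
  have even_sum: "(m * n + 3) div 2 = m * q + p + 2"
    by (simp add: m n algebra_simps)
  have "m * n - 3 = 2 * (m * q + p - 1)" by (simp add: m n algebra_simps)
  then have odd_sum: "(m * n - 3) div 2 = m * q + p - 1" by simp
  \<comment> \<open>The reflected indices are put in the form \<open>2 * c\<close> or
    \<open>2 * c - 1\<close>, so that \<open>HALL_eqs\<close> applies to them.\<close>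
  have reflect:
    "m + 1 - 2 * a = 2 * (p + 1 - a)" "m + 1 - (2 * a - 1) = 2 * (p + 2 - a) - 1"
    "n + 1 - 2 * a = 2 * (q + 1 - a)" "n + 1 - (2 * a - 1) = 2 * (q + 2 - a) - 1" for a
    by (simp_all add: m n)
  show ?thesis
    unfolding even_sum odd_sum
    by (cases i rule: parity_cases; cases j rule: parity_cases;
        simp only: reflect HALL_eqs half_ceil; simp add: m algebra_simps)
qed

text \<open>A step of two keeps the parity class and raises \<open>a\<close> by 1; the sign of
  \<open>a\<close> depends only on the parity of \<open>i + j\<close>. This gives the strict
  monotonicity along the central column.\<close>

lemma HALL_step_row:
  "HALL M N m n (i + 2) j = HALL M N m n i j + (if even (i + j) then 1 else - 1)"
  by (cases "even i"; cases "even j"; elim evenE oddE)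
    (simp_all add: HALL_def Let_def algebra_simps)

lemma HALL_step_column:
  "HALL M N m n i (j + 2) = HALL M N m n i j + (if even (i + j) then m else - m)"
  by (cases "even i"; cases "even j"; elim evenE oddE)
    (simp_all add: HALL_def Let_def algebra_simps)

lemma partial_bicentrally_balanced_HALL:
  assumes "odd m" "m \<ge> 1" "odd n" "n \<ge> 1"
  shows "partial_bicentrally_balanced M N m n (HALL M N m n)"
  unfolding partial_bicentrally_balanced_def C4_faces_magic_iff
    HALL_even_labels[OF assms] HALL_odd_labels[OF assms]
  using assms
  by (auto simp: HALL_face_sum HALL_central_sum HALL_step_row HALL_step_column)

theorem theorem35:
  fixes m n M N :: int
  assumes "odd m" and "m \<ge> 3" and "odd n" and "n \<ge> 3"
    and "odd M" and "M \<ge> m" and "odd N" and "N \<ge> n"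
  shows "partial_bicentrally_balanced M N m n (HALL M N m n) \<and>
         partial_bicentrally_balanced M N m n (VALL M N m n)"
  \<comment> \<open>The second conjunct transposes the balanced labeling
    \<open>HALL N M n m\<close>.\<close>
  unfolding VALL_eq_HALL_transpose using assms
  by (intro conjI partial_bicentrally_balanced_HALL partial_bicentrally_balanced_transpose) auto

end
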